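(* Let $\mathcal{H}$ be a complex Hilbert space and let $T\in\mathcal{B}(\mathcal{H})$. Then $$w^2(T)\leq \min_{0\leq\alpha\leq 1}\left\|\alpha|T|^2+(1-\alpha)|T^*|^2\right\|.$$
   Context: $\mathcal{B}(\mathcal{H})$ is the $C^*$-algebra of all bounded linear operators on the complex Hilbert space $\mathcal{H}$ with inner product $\langle\cdot,\cdot\rangle$; $\|\cdot\|$ is the operator norm and $T^*$ is the adjoint of $T$. $|T|=(T^*T)^{1/2}$ and $|T^*|=(TT^* )^{1/2}$. The numerical radius of $T$ is $w(T)=\sup\{|\langle Tx,x\rangle| : x\in\mathcal{H},\ \|x\|=1\}$, and $w^2(T)$ means $(w(T))^2$. *)

theory Defs
  imports "HOL-Analysis.Analysis"
begin

text \<open>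
  Complex Hilbert spaces. The inner product is linear in its first argument. The axiom
  \<open>cinner_self\<close> says both that the inner product is positive definite and that it induces the
  norm for which the space is complete.
\<close>

class chilbert_space = banach +
  fixes scaleC :: "complex \<Rightarrow> 'a \<Rightarrow> 'a" (infixr "*\<^sub>C" 75)
    and cinner :: "'a \<Rightarrow> 'a \<Rightarrow> complex"
  assumes scaleR_scaleC: "r *\<^sub>R x = complex_of_real r *\<^sub>C x"
    and scaleC_add_right: "a *\<^sub>C (x + y) = a *\<^sub>C x + a *\<^sub>C y"
    and scaleC_add_left: "(a + b) *\<^sub>C x = a *\<^sub>C x + b *\<^sub>C x"
    and scaleC_scaleC: "a *\<^sub>C (b *\<^sub>C x) = (a * b) *\<^sub>C x"
    and cinner_commute: "cinner x y = cnj (cinner y x)"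
    and cinner_add_left: "cinner (x + y) z = cinner x z + cinner y z"
    and cinner_scaleC_left: "cinner (a *\<^sub>C x) y = a * cinner x y"
    and cinner_self: "cinner x x = complex_of_real ((norm x)\<^sup>2)"

instantiation complex :: chilbert_space
begin

definition scaleC_complex :: "complex \<Rightarrow> complex \<Rightarrow> complex"
  where "scaleC_complex a x = a * x"

definition cinner_complex :: "complex \<Rightarrow> complex \<Rightarrow> complex"
  where "cinner_complex x y = x * cnj y"

instance
  by standard
    (simp_all add: scaleC_complex_def cinner_complex_def scaleR_conv_of_real algebra_simps
      complex_norm_square[symmetric] del: of_real_power)

end

text \<open>
  The type \<open>'a \<Rightarrow>\<^sub>L 'a\<close> consists of the bounded real-linear operators, normed by the operator norm;
  the bounded complex-linear operators are the members of it satisfying \<open>clinear_op\<close>.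
\<close>

definition clinear_op :: "('a::chilbert_space \<Rightarrow>\<^sub>L 'a) \<Rightarrow> bool"
  where "clinear_op T \<longleftrightarrow> (\<forall>c x. T (c *\<^sub>C x) = c *\<^sub>C T x)"

definition adjoint_op :: "('a::chilbert_space \<Rightarrow>\<^sub>L 'a) \<Rightarrow> ('a \<Rightarrow>\<^sub>L 'a)"
  where "adjoint_op T = (THE S :: 'a \<Rightarrow>\<^sub>L 'a. \<forall>x y. cinner (T x) y = cinner x (S y))"

definition positive_op :: "('a::chilbert_space \<Rightarrow>\<^sub>L 'a) \<Rightarrow> bool"
  where "positive_op A \<longleftrightarrow> clinear_op A \<and> (\<forall>x. cinner (A x) x \<in> \<real>\<^sub>\<ge>\<^sub>0)"

definition sqrt_op :: "('a::chilbert_space \<Rightarrow>\<^sub>L 'a) \<Rightarrow> ('a \<Rightarrow>\<^sub>L 'a)"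
  where "sqrt_op A = (THE B. positive_op B \<and> B o\<^sub>L B = A)"

definition abs_op :: "('a::chilbert_space \<Rightarrow>\<^sub>L 'a) \<Rightarrow> ('a \<Rightarrow>\<^sub>L 'a)"
  where "abs_op T = sqrt_op (adjoint_op T o\<^sub>L T)"

text \<open>
  The supremum is the one in \<open>[0, \<infinity>)\<close>: inserting \<open>0\<close> has an effect only on the zero space, which
  has no unit vectors and where the real supremum of the empty set is unspecified.
\<close>

definition numerical_radius :: "('a::chilbert_space \<Rightarrow>\<^sub>L 'a) \<Rightarrow> real"
  where "numerical_radius T = Sup (insert 0 {cmod (cinner (T x) x) | x. norm x = 1})"

end

theory Submission
  imports Defs
begin

text \<open>
  For a unit vector \<open>x\<close> the Cauchy--Schwarz inequality bounds \<open>\<bar>\<langle>Tx, x\<rangle>\<bar> = \<bar>\<langle>x, T\<^sup>*x\<rangle>\<bar>\<close> both by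
  \<open>\<parallel>Tx\<parallel>\<close> and by \<open>\<parallel>T\<^sup>*x\<parallel>\<close>. Hence its square is at most any convex combination
  \<open>\<alpha> \<parallel>Tx\<parallel>\<^sup>2 + (1 - \<alpha>) \<parallel>T\<^sup>*x\<parallel>\<^sup>2 = \<langle>(\<alpha> \<bar>T\<bar>\<^sup>2 + (1 - \<alpha>) \<bar>T\<^sup>*\<bar>\<^sup>2) x, x\<rangle>\<close>, which the operator norm bounds.
  The minimum over \<open>\<alpha>\<close> is attained because the norm depends continuously on \<open>\<alpha> \<in> [0, 1]\<close>.

  The substance lies in \<open>\<bar>T\<bar>\<^sup>2 = T\<^sup>*T\<close> (lemma \<open>abs_op_squared\<close>): adjoint and square root are given by
  definite descriptions, so existence and uniqueness of both must be established. The adjoint comes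
  from the Riesz representation theorem (\<open>riesz_representation\<close>), proved by minimising
  \<open>\<parallel>y\<parallel>\<^sup>2 - 2 f(y)\<close>. For a positive \<open>A\<close> with \<open>\<parallel>A\<parallel> \<le> 1\<close>, the operator \<open>B\<close> is a square root of \<open>A\<close>
  if and only if \<open>Y = 1 - B\<close> satisfies \<open>Y = (X + Y\<^sup>2) / 2\<close> with \<open>X = 1 - A\<close>; the iteration of this
  equation from \<open>0\<close> converges in norm since it is dominated by the same iteration for the number \<open>1\<close>
  in place of \<open>X\<close> (\<open>norm_sqrt_iter_diff_le\<close>). The square root so obtained commutes with everything
  that commutes with \<open>A\<close>, in particular with any other positive square root, and this forces the two
  to coincide (\<open>commuting_positive_sqrt_unique\<close>).
\<close>

section \<open>The inner product\<close>

lemma cinner_add_right: "cinner x (y + z) = cinner x y + cinner x (z :: 'a::chilbert_space)"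
  by (metis cinner_add_left cinner_commute complex_cnj_add)

lemma cinner_scaleC_right: "cinner x (a *\<^sub>C y) = cnj a * cinner x (y :: 'a::chilbert_space)"
  by (metis cinner_scaleC_left cinner_commute complex_cnj_mult)

lemma Re_cinner_self: "Re (cinner x x) = (norm (x :: 'a::chilbert_space))\<^sup>2"
  by (simp add: cinner_self)

lemma Re_cinner_commute: "Re (cinner x y) = Re (cinner y (x :: 'a::chilbert_space))"
  by (metis cinner_commute cnj.sel(1))

lemma norm_add_squared:
  "(norm (x + y))\<^sup>2 = (norm x)\<^sup>2 + 2 * Re (cinner x y) + (norm (y :: 'a::chilbert_space))\<^sup>2"
proof -
  have "(norm (x + y))\<^sup>2 = Re (cinner (x + y) (x + y))"
    by (simp add: Re_cinner_self)
  also have "\<dots> = Re (cinner x x) + Re (cinner x y) + Re (cinner y x) + Re (cinner y y)"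
    by (simp add: cinner_add_left cinner_add_right)
  finally show ?thesis
    by (simp add: Re_cinner_self Re_cinner_commute[of y x])
qed

lemma norm_scaleC: "norm (a *\<^sub>C x) = cmod a * norm (x :: 'a::chilbert_space)"
proof (rule power2_eq_imp_eq)
  have "complex_of_real ((norm (a *\<^sub>C x))\<^sup>2) = a * cnj a * cinner x x"
    by (simp add: cinner_self[symmetric] cinner_scaleC_left cinner_scaleC_right del: of_real_power)
  also have "\<dots> = complex_of_real ((cmod a * norm x)\<^sup>2)"
    by (simp add: cinner_self complex_norm_square[symmetric] power_mult_distrib)
  finally show "(norm (a *\<^sub>C x))\<^sup>2 = (cmod a * norm x)\<^sup>2"
    using of_real_eq_iff by blast
qed auto

text \<open>
  The norm is already known to satisfy the triangle inequality, and squaring it gives the bound for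
  the real part.
\<close>

lemma Re_cinner_le: "Re (cinner x y) \<le> norm x * norm (y :: 'a::chilbert_space)"
proof -
  have "(norm (x + y))\<^sup>2 \<le> (norm x + norm y)\<^sup>2"
    by (intro power_mono norm_triangle_ineq) auto
  then show ?thesis
    by (simp add: norm_add_squared power2_sum)
qed

lemma cmod_cinner_le: "cmod (cinner x y) \<le> norm x * norm (y :: 'a::chilbert_space)"
proof (cases "cinner x y = 0")
  case False
  \<comment> \<open>Rotating \<open>x\<close> by the phase of the inner product makes the inner product real.\<close>
  define u where "u = cnj (cinner x y) / cmod (cinner x y)"
  have u: "cmod u = 1"
    using False by (simp add: u_def norm_divide)
  have "cinner (u *\<^sub>C x) y = cmod (cinner x y)"
    using False complex_norm_square[of "cinner x y"]
    by (simp add: u_def cinner_scaleC_left field_simps power2_eq_square)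
  then have "cmod (cinner x y) = Re (cinner (u *\<^sub>C x) y)"
    by simp
  also have "\<dots> \<le> norm (u *\<^sub>C x) * norm y"
    by (rule Re_cinner_le)
  finally show ?thesis
    by (simp add: norm_scaleC u)
qed simp

lemma bounded_bilinear_cinner: "bounded_bilinear (cinner :: 'a::chilbert_space \<Rightarrow> 'a \<Rightarrow> complex)"
proof
  show "cinner (r *\<^sub>R x) y = r *\<^sub>R cinner x y" for r and x y :: 'a
    by (simp add: scaleR_scaleC[of r x] cinner_scaleC_left scaleR_conv_of_real)
  show "cinner x (r *\<^sub>R y) = r *\<^sub>R cinner x y" for r and x y :: 'a
    by (simp add: scaleR_scaleC[of r y] cinner_scaleC_right scaleR_conv_of_real)
  show "\<exists>K. \<forall>x y :: 'a. norm (cinner x y) \<le> norm x * norm y * K"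
    by (intro exI[of _ 1]) (simp add: cmod_cinner_le)
qed (simp_all add: cinner_add_left cinner_add_right)

interpretation cinner: bounded_bilinear "cinner :: 'a::chilbert_space \<Rightarrow> 'a \<Rightarrow> complex"
  by (rule bounded_bilinear_cinner)

lemma cinner_eq_imp_eq:
  assumes "\<And>x. cinner x y = cinner x (z :: 'a::chilbert_space)"
  shows "y = z"
proof -
  have "cinner (y - z) (y - z) = 0"
    using assms[of "y - z"] by (simp add: cinner.diff_right)
  then show ?thesis
    by (simp add: cinner_self)
qed

section \<open>The Riesz representation theorem and adjoints\<close>

lemma quadratic_nonneg_imp_linear_coeff_zero:
  fixes a b :: real
  assumes "\<And>t. 0 \<le> 2 * t * a + t\<^sup>2 * b"
  shows "a = 0"
proof (rule ccontr)
  assume "a \<noteq> 0"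
  \<comment> \<open>At \<open>t = - s a\<close> with small \<open>s > 0\<close> the linear term outweighs the quadratic one.\<close>
  define s where "s = 1 / (1 + \<bar>b\<bar>)"
  have s: "0 < s" "s * \<bar>b\<bar> < 1"
    by (auto simp: s_def field_simps)
  have "0 \<le> 2 * (- s * a) * a + (- s * a)\<^sup>2 * b"
    by (rule assms)
  also have "\<dots> = s * a\<^sup>2 * (s * b - 2)"
    by (simp add: power2_eq_square algebra_simps)
  finally have "0 \<le> s * a\<^sup>2 * (s * b - 2)" .
  moreover have "0 < s * a\<^sup>2"
    using s \<open>a \<noteq> 0\<close> by simp
  ultimately have "0 \<le> s * b - 2"
    by (simp only: zero_le_mult_iff) linarith
  moreover have "s * b \<le> s * \<bar>b\<bar>"
    using s by (simp add: mult_left_mono)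
  ultimately show False
    using s by linarith
qed

text \<open>
  The representing vector minimises \<open>J(y) = \<parallel>y\<parallel>\<^sup>2 - 2 f(y)\<close>. The parallelogram law makes every
  minimising sequence of \<open>J\<close> a Cauchy sequence, and the vanishing of the first variation of \<open>J\<close> at
  the minimiser is the asserted identity.
\<close>

theorem riesz_representation:
  fixes f :: "'a::chilbert_space \<Rightarrow> real"
  assumes "bounded_linear f"
  shows "\<exists>z. \<forall>y. f y = Re (cinner y z)"
proof -
  interpret f: bounded_linear f by fact
  define J where "J y = (norm y)\<^sup>2 - 2 * f y" for y
  define m where "m = Inf (range J)"
  obtain K where K: "\<And>y. norm (f y) \<le> norm y * K"
    using f.bounded by blast
  have J_lower: "- K\<^sup>2 \<le> J y" for y
  proof -
    have "f y \<le> norm y * K"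
      using K[of y] by simp
    then have "(norm y - K)\<^sup>2 - K\<^sup>2 \<le> J y"
      by (simp add: J_def power2_diff)
    then show ?thesis
      using zero_le_power2[of "norm y - K"] by linarith
  qed
  have bdd: "bdd_below (range J)"
    using J_lower by (intro bdd_belowI[of _ "- K\<^sup>2"]) auto
  have m_le: "m \<le> J y" for y
    unfolding m_def using bdd by (auto intro: cInf_lower)
  have "\<exists>y. J y < m + inverse (Suc n)" for n
    using cInf_lessD[of "range J" "m + inverse (Suc n)"] by (auto simp: m_def)
  then obtain s where s: "\<And>n. J (s n) < m + inverse (Suc n)"
    by metis
  have gap: "(norm (x - y))\<^sup>2 + 4 * m \<le> 2 * J x + 2 * J y" for x y
  proof -
    define c where "c = (1/2) *\<^sub>R (x + y)"
    have "4 * J c = (norm (x + y))\<^sup>2 - 4 * (f x + f y)"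
      by (simp add: c_def J_def f.scaleR f.add power_divide algebra_simps del: scaleR_add_right)
    then have "(norm (x - y))\<^sup>2 = 2 * J x + 2 * J y - 4 * J c"
      using norm_add_squared[of x "- y"] norm_add_squared[of x y]
      by (simp add: J_def cinner.minus_right)
    then show ?thesis
      using m_le[of c] by simp
  qed
  have "Cauchy s"
  proof (rule metric_CauchyI)
    fix e :: real assume "0 < e"
    then obtain M where M: "inverse (Suc M) < e\<^sup>2 / 4"
      using reals_Archimedean[of "e\<^sup>2 / 4"] by auto
    have close: "4 * J (s n) < 4 * m + e\<^sup>2" if "M \<le> n" for n
    proof -
      have "inverse (real (Suc n)) \<le> inverse (real (Suc M))"
        using that by (intro le_imp_inverse_le) auto
      then show ?thesis
        using s[of n] M by linarith
    qed
    have "dist (s n) (s k) < e" if "M \<le> n" "M \<le> k" for n k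
    proof -
      have "(norm (s n - s k))\<^sup>2 < e\<^sup>2"
        using gap[of "s n" "s k"] close[OF that(1)] close[OF that(2)] by simp
      then show ?thesis
        using \<open>0 < e\<close> by (simp add: dist_norm power_less_imp_less_base)
    qed
    then show "\<exists>M. \<forall>n\<ge>M. \<forall>k\<ge>M. dist (s n) (s k) < e"
      by blast
  qed
  then obtain z where z: "s \<longlonglongrightarrow> z"
    using Cauchy_convergent_iff convergent_def by blast
  have "(\<lambda>n. J (s n)) \<longlonglongrightarrow> J z"
    unfolding J_def by (intro tendsto_intros f.tendsto z)
  moreover have "(\<lambda>n. m + inverse (Suc n)) \<longlonglongrightarrow> m + 0"
    by (intro tendsto_intros LIMSEQ_inverse_real_of_nat)
  ultimately have "J z \<le> m + 0"
    by (rule LIMSEQ_le) (use s less_imp_le in blast)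
  then have min: "J z \<le> J y" for y
    using m_le[of y] by simp
  have "f y = Re (cinner y z)" for y
  proof -
    have "0 \<le> 2 * t * (Re (cinner y z) - f y) + t\<^sup>2 * (norm y)\<^sup>2" for t
      using min[of "z + t *\<^sub>R y"] Re_cinner_commute[of y z]
      by (simp add: J_def norm_add_squared f.add f.scaleR cinner.scaleR_right power_mult_distrib
          algebra_simps)
    then show ?thesis
      using quadratic_nonneg_imp_linear_coeff_zero by fastforce
  qed
  then show ?thesis by blast
qed

lemma adjoint_op_exists:
  fixes T :: "'a::chilbert_space \<Rightarrow>\<^sub>L 'a"
  assumes T: "clinear_op T"
  shows "\<exists>S :: 'a \<Rightarrow>\<^sub>L 'a. \<forall>x y. cinner (T x) y = cinner x (S y)"
proof -
  have "\<exists>z. \<forall>x. Re (cinner (T x) y) = Re (cinner x z)" for y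
    by (rule riesz_representation) (intro bounded_linear_compose[OF bounded_linear_Re]
        bounded_linear_compose[OF cinner.bounded_linear_left] blinfun.bounded_linear_right)
  then obtain S where S: "\<And>x y. Re (cinner (T x) y) = Re (cinner x (S y))"
    by metis
  \<comment> \<open>The imaginary part of an inner product is the real part after rotating by \<open>-\<i>\<close>.\<close>
  have Im: "Im (cinner x y) = Re (cinner ((- \<i>) *\<^sub>C x) y)" for x y :: 'a
    by (simp add: cinner_scaleC_left)
  have adj: "cinner (T x) y = cinner x (S y)" for x y
  proof (rule complex_eqI)
    show "Im (cinner (T x) y) = Im (cinner x (S y))"
      using T S[of "(- \<i>) *\<^sub>C x" y] by (simp only: Im clinear_op_def)
  qed (rule S)
  have "bounded_linear S"
  proof
    show "S (x + y) = S x + S y" for x y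
      by (rule cinner_eq_imp_eq) (simp add: adj[symmetric] cinner_add_right)
    show "S (r *\<^sub>R x) = r *\<^sub>R S x" for r x
      by (rule cinner_eq_imp_eq) (simp add: adj[symmetric] cinner.scaleR_right)
    show "\<exists>K. \<forall>x. norm (S x) \<le> norm x * K"
    proof (intro exI allI)
      fix x
      have "norm (S x) * norm (S x) = Re (cinner (T (S x)) x)"
        by (simp add: S Re_cinner_self power2_eq_square)
      also have "\<dots> \<le> norm (T (S x)) * norm x"
        by (rule Re_cinner_le)
      also have "\<dots> \<le> norm (S x) * (norm x * norm T)"
        using mult_right_mono[OF norm_blinfun[of T "S x"], of "norm x"] by (simp add: mult_ac)
      finally show "norm (S x) \<le> norm x * norm T"
        by (cases "S x = 0") simp_all
    qed
  qed
  then have "\<forall>x y. cinner (T x) y = cinner x (Blinfun S y)"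
    by (simp add: bounded_linear_Blinfun_apply adj)
  then show ?thesis by blast
qed

lemma cinner_adjoint_op:
  fixes T :: "'a::chilbert_space \<Rightarrow>\<^sub>L 'a"
  assumes "clinear_op T"
  shows "cinner (T x) y = cinner x (adjoint_op T y)"
proof -
  have "\<exists>!S :: 'a \<Rightarrow>\<^sub>L 'a. \<forall>x y. cinner (T x) y = cinner x (S y)"
  proof (rule ex_ex1I[OF adjoint_op_exists[OF assms]])
    fix S R :: "'a \<Rightarrow>\<^sub>L 'a"
    assume "\<forall>x y. cinner (T x) y = cinner x (S y)" "\<forall>x y. cinner (T x) y = cinner x (R y)"
    then have "cinner x (S y) = cinner x (R y)" for x y
      by metis
    then show "S = R"
      by (rule blinfun_eqI[OF cinner_eq_imp_eq])
  qed
  from theI'[OF this] show ?thesis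
    unfolding adjoint_op_def by blast
qed

lemma clinear_op_adjoint_op:
  assumes "clinear_op T"
  shows "clinear_op (adjoint_op T)"
  unfolding clinear_op_def
proof (intro allI, rule cinner_eq_imp_eq)
  fix c x y
  show "cinner y (adjoint_op T (c *\<^sub>C x)) = cinner y (c *\<^sub>C adjoint_op T x)"
    by (simp add: cinner_adjoint_op[OF assms, symmetric] cinner_scaleC_right)
qed

section \<open>Self-adjoint and positive operators\<close>

definition selfadjoint_op :: "('a::chilbert_space \<Rightarrow>\<^sub>L 'a) \<Rightarrow> bool"
  where "selfadjoint_op A \<longleftrightarrow> (\<forall>x y. cinner (A x) y = cinner x (A y))"

lemma selfadjoint_opD: "selfadjoint_op A \<Longrightarrow> cinner (A x) y = cinner x (A y)"
  by (simp add: selfadjoint_op_def)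

lemma selfadjoint_op_imp_clinear_op:
  assumes "selfadjoint_op A"
  shows "clinear_op A"
  unfolding clinear_op_def
proof (intro allI, rule cinner_eq_imp_eq)
  fix c x y
  show "cinner y (A (c *\<^sub>C x)) = cinner y (c *\<^sub>C A x)"
    by (simp add: selfadjoint_opD[OF assms, symmetric] cinner_scaleC_right)
qed

lemma selfadjoint_op_zero: "selfadjoint_op 0"
  and selfadjoint_op_id: "selfadjoint_op id_blinfun"
  and selfadjoint_op_add: "selfadjoint_op A \<Longrightarrow> selfadjoint_op B \<Longrightarrow> selfadjoint_op (A + B)"
  and selfadjoint_op_diff: "selfadjoint_op A \<Longrightarrow> selfadjoint_op B \<Longrightarrow> selfadjoint_op (A - B)"
  and selfadjoint_op_scaleR: "selfadjoint_op A \<Longrightarrow> selfadjoint_op (r *\<^sub>R A)"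
  and selfadjoint_op_square: "selfadjoint_op A \<Longrightarrow> selfadjoint_op (A o\<^sub>L A)"
  by (simp_all add: selfadjoint_op_def blinfun.bilinear_simps cinner.add_left cinner.add_right
      cinner.diff_left cinner.diff_right cinner.scaleR_left cinner.scaleR_right
      cinner.zero_left cinner.zero_right)

lemma selfadjoint_op_limit:
  assumes "\<And>n. selfadjoint_op (A n)" and "A \<longlonglongrightarrow> L"
  shows "selfadjoint_op L"
  unfolding selfadjoint_op_def
proof (intro allI)
  fix x y
  have "(\<lambda>n. cinner (A n x) y) \<longlonglongrightarrow> cinner (L x) y"
    by (intro cinner.tendsto blinfun.tendsto assms tendsto_const)
  moreover have "(\<lambda>n. cinner x (A n y)) \<longlonglongrightarrow> cinner x (L y)"
    by (intro cinner.tendsto blinfun.tendsto assms tendsto_const)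
  ultimately show "cinner (L x) y = cinner x (L y)"
    by (simp add: selfadjoint_opD[OF assms(1)] LIMSEQ_unique)
qed

text \<open>
  Complex linearity is part of positivity; here it comes for free from self-adjointness, so the
  square root iteration has to preserve self-adjointness only.
\<close>

lemma selfadjoint_op_imp_positive_op:
  assumes A: "selfadjoint_op A" and "\<And>x. 0 \<le> Re (cinner (A x) x)"
  shows "positive_op A"
proof -
  have "cinner (A x) x = cnj (cinner (A x) x)" for x
    by (metis A cinner_commute selfadjoint_opD)
  then have "Im (cinner (A x) x) = 0" for x
    by (metis add.inverse_unique cnj.sel(2) equation_minus_iff neg_equal_zero)
  then show ?thesis
    using assms selfadjoint_op_imp_clinear_op
    by (auto simp: positive_op_def complex_nonneg_Reals_iff)
qed

text \<open>
  The form \<open>h(x, y) = \<langle>Ax, y\<rangle> - \<langle>x, Ay\<rangle>\<close> vanishes on the diagonal because \<open>\<langle>Ax, x\<rangle>\<close> is real; over the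
  complex numbers polarization then makes it vanish everywhere.
\<close>

lemma positive_op_imp_selfadjoint_op:
  assumes "positive_op A"
  shows "selfadjoint_op A"
proof -
  define h where "h x y = cinner (A x) y - cinner x (A y)" for x y
  have A: "A (c *\<^sub>C x) = c *\<^sub>C A x" and pos: "cinner (A x) x \<in> \<real>\<^sub>\<ge>\<^sub>0" for c x
    using assms by (auto simp: positive_op_def clinear_op_def)
  have diag: "h x x = 0" for x
  proof -
    have "cnj (cinner (A x) x) = cinner (A x) x"
      using pos[of x] by (auto simp: complex_nonneg_Reals_iff complex_eq_iff)
    then show ?thesis
      using cinner_commute[of x "A x"] by (simp add: h_def)
  qed
  have anti: "h x y + h y x = 0" for x y
    using diag[of "x + y"] diag[of x] diag[of y]
    by (simp add: h_def blinfun.add_right cinner_add_left cinner_add_right algebra_simps)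
  have "h x y = 0" for x y
  proof -
    have "h (\<i> *\<^sub>C x) y = \<i> * h x y" "h y (\<i> *\<^sub>C x) = - \<i> * h y x"
      by (simp_all add: h_def A cinner_scaleC_left cinner_scaleC_right algebra_simps)
    then have "\<i> * (h x y - h y x) = 0"
      using anti[of "\<i> *\<^sub>C x" y] by (simp add: algebra_simps)
    then show ?thesis
      using anti[of x y] by simp
  qed
  then show ?thesis
    by (simp add: selfadjoint_op_def h_def)
qed

lemma positive_op_Re_nonneg: "positive_op A \<Longrightarrow> 0 \<le> Re (cinner (A x) x)"
  by (simp add: positive_op_def complex_nonneg_Reals_iff)

lemma Re_cinner_image_le:
  fixes A :: "'a::chilbert_space \<Rightarrow>\<^sub>L 'a"
  shows "Re (cinner (A x) x) \<le> norm A * (norm x)\<^sup>2"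
proof -
  have "Re (cinner (A x) x) \<le> norm (A x) * norm x"
    by (rule Re_cinner_le)
  also have "\<dots> \<le> norm A * norm x * norm x"
    by (intro mult_right_mono norm_blinfun) auto
  finally show ?thesis
    by (simp add: power2_eq_square mult_ac)
qed

text \<open>
  A substitute for the Cauchy--Schwarz inequality of the form \<open>\<langle>Ax, y\<rangle>\<close>, read off from its
  nonnegativity at \<open>\<parallel>A\<parallel> x - Ax\<close>. It yields that \<open>\<langle>Ax, x\<rangle> = 0\<close> implies \<open>Ax = 0\<close>, and that \<open>1 - A\<close>
  is a contraction when \<open>\<parallel>A\<parallel> \<le> 1\<close>.
\<close>

lemma positive_op_norm_squared_le:
  assumes A: "positive_op A"
  shows "(norm (A x))\<^sup>2 \<le> norm A * Re (cinner (A x) x)"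
proof (cases "A = 0")
  case False
  define a where "a = norm A"
  have a: "0 < a"
    using False by (simp add: a_def)
  have "cinner (A (A x)) x = cinner (A x) (A x)"
    using A by (intro selfadjoint_opD positive_op_imp_selfadjoint_op)
  then have "Re (cinner (A (a *\<^sub>R x - A x)) (a *\<^sub>R x - A x)) =
      a\<^sup>2 * Re (cinner (A x) x) - 2 * a * (norm (A x))\<^sup>2 + Re (cinner (A (A x)) (A x))"
    by (simp add: blinfun.diff_right blinfun.scaleR_right cinner.diff_left cinner.diff_right
        cinner.scaleR_left cinner.scaleR_right Re_cinner_self power2_eq_square algebra_simps)
  moreover have "Re (cinner (A (A x)) (A x)) \<le> a * (norm (A x))\<^sup>2"
    unfolding a_def by (rule Re_cinner_image_le)
  ultimately have "a * (norm (A x))\<^sup>2 \<le> a * (a * Re (cinner (A x) x))"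
    using positive_op_Re_nonneg[OF A, of "a *\<^sub>R x - A x"]
    by (simp add: power2_eq_square algebra_simps)
  then show ?thesis
    using a by (simp add: a_def)
qed simp

lemma positive_op_eq_zero:
  assumes "positive_op A" and "Re (cinner (A x) x) = 0"
  shows "A x = 0"
  using positive_op_norm_squared_le[OF assms(1), of x] assms(2) by simp

lemma norm_id_minus_positive_op_le:
  assumes A: "positive_op A" and "norm A \<le> 1"
  shows "norm (id_blinfun - A) \<le> 1"
proof (rule norm_blinfun_bound)
  fix x
  have "(norm (A x))\<^sup>2 \<le> norm A * Re (cinner (A x) x)"
    by (rule positive_op_norm_squared_le[OF A])
  also have "\<dots> \<le> 1 * Re (cinner (A x) x)"
    using assms by (intro mult_right_mono positive_op_Re_nonneg)
  finally have "(norm (x - A x))\<^sup>2 \<le> (norm x)\<^sup>2"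
    using norm_add_squared[of x "- A x"] positive_op_Re_nonneg[OF A, of x]
      Re_cinner_commute[of x "A x"]
    by (simp add: cinner.minus_right)
  then have "norm (x - A x) \<le> norm x"
    by (rule power2_le_imp_le) simp
  then show "norm ((id_blinfun - A) x) \<le> 1 * norm x"
    by (simp add: blinfun.diff_left)
qed simp

section \<open>The positive square root\<close>

text \<open>
  The fixed points \<open>Y\<close> of this iteration are those with \<open>(1 - Y)\<^sup>2 = 1 - X\<close>.
\<close>

primrec sqrt_iter :: "('a::real_normed_vector \<Rightarrow>\<^sub>L 'a) \<Rightarrow> nat \<Rightarrow> ('a \<Rightarrow>\<^sub>L 'a)"
  where
    "sqrt_iter X 0 = 0"
  | "sqrt_iter X (Suc n) = (1/2) *\<^sub>R (X + (sqrt_iter X n o\<^sub>L sqrt_iter X n))"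

text \<open>The scalar iteration for \<open>X = 1\<close>, which increases to the fixed point \<open>1\<close>.\<close>

primrec sqrt_iter_bound :: "nat \<Rightarrow> real"
  where
    "sqrt_iter_bound 0 = 0"
  | "sqrt_iter_bound (Suc n) = (1 + (sqrt_iter_bound n)\<^sup>2) / 2"

lemma sqrt_iter_bound_in_unit_interval: "0 \<le> sqrt_iter_bound n \<and> sqrt_iter_bound n \<le> 1"
  by (induction n) (auto simp: power_le_one)

lemma sqrt_iter_bound_le_Suc: "sqrt_iter_bound n \<le> sqrt_iter_bound (Suc n)"
  using sum_power2_ge_zero[of "1 - sqrt_iter_bound n" 0] by (simp add: power2_eq_square algebra_simps)

lemma convergent_sqrt_iter_bound: "convergent sqrt_iter_bound"
proof -
  have "incseq sqrt_iter_bound"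
    by (intro incseq_SucI sqrt_iter_bound_le_Suc)
  moreover have "Bseq sqrt_iter_bound"
    using sqrt_iter_bound_in_unit_interval by (intro BseqI'[of _ 1]) auto
  ultimately show ?thesis
    by (auto intro: Bseq_monoseq_convergent simp: monoseq_iff)
qed

lemma norm_blinfun_square_diff_le:
  fixes P Q :: "'a::real_normed_vector \<Rightarrow>\<^sub>L 'a"
  shows "norm ((P o\<^sub>L P) - (Q o\<^sub>L Q)) \<le> (norm P + norm Q) * norm (P - Q)"
proof -
  have "(P o\<^sub>L P) - (Q o\<^sub>L Q) = (P o\<^sub>L (P - Q)) + ((P - Q) o\<^sub>L Q)"
    by (rule blinfun_eqI) (simp add: blinfun.bilinear_simps)
  also have "norm \<dots> \<le> norm P * norm (P - Q) + norm (P - Q) * norm Q"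
    by (intro norm_triangle_mono norm_blinfun_compose)
  finally show ?thesis
    by (simp add: algebra_simps)
qed

lemma norm_sqrt_iter_le:
  assumes "norm X \<le> 1"
  shows "norm (sqrt_iter X n) \<le> sqrt_iter_bound n"
proof (induction n)
  case (Suc n)
  have "norm (X + (sqrt_iter X n o\<^sub>L sqrt_iter X n)) \<le> 1 + norm (sqrt_iter X n) * norm (sqrt_iter X n)"
    by (intro norm_triangle_mono assms norm_blinfun_compose)
  also have "\<dots> \<le> 1 + (sqrt_iter_bound n)\<^sup>2"
    using mult_mono[OF Suc Suc] sqrt_iter_bound_in_unit_interval[of n]
    by (simp add: power2_eq_square)
  finally show ?case
    by simp
qed simp

text \<open>
  A difference of squares has norm at most the sum of the norms times the norm of the difference, with
  equality for nonnegative numbers; so each step of the operator iteration is dominated by the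
  same step of the scalar one.
\<close>

lemma norm_sqrt_iter_step_le:
  assumes "norm X \<le> 1"
  shows "norm (sqrt_iter X (Suc n) - sqrt_iter X n) \<le> sqrt_iter_bound (Suc n) - sqrt_iter_bound n"
proof (induction n)
  case 0
  then show ?case using assms by simp
next
  case (Suc n)
  let ?P = "sqrt_iter X (Suc n)" and ?Q = "sqrt_iter X n"
  let ?p = "sqrt_iter_bound (Suc n)" and ?q = "sqrt_iter_bound n"
  have "sqrt_iter X (Suc (Suc n)) - ?P = (1/2) *\<^sub>R (((?P o\<^sub>L ?P) - (?Q o\<^sub>L ?Q)))"
    by (simp add: scaleR_diff_right scaleR_add_right)
  then have "norm (sqrt_iter X (Suc (Suc n)) - ?P) = norm ((?P o\<^sub>L ?P) - (?Q o\<^sub>L ?Q)) / 2"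
    by (simp del: sqrt_iter.simps)
  also have "\<dots> \<le> (norm ?P + norm ?Q) * norm (?P - ?Q) / 2"
    by (intro divide_right_mono norm_blinfun_square_diff_le) simp
  also have "\<dots> \<le> (?p + ?q) * (?p - ?q) / 2"
    using sqrt_iter_bound_in_unit_interval
    by (intro divide_right_mono mult_mono add_mono norm_sqrt_iter_le[OF assms] Suc add_nonneg_nonneg)
      (auto simp del: sqrt_iter_bound.simps)
  also have "\<dots> = sqrt_iter_bound (Suc (Suc n)) - ?p"
    by (simp add: power2_eq_square algebra_simps diff_divide_distrib add_divide_distrib)
  finally show ?case .
qed

lemma norm_sqrt_iter_diff_le:
  assumes "norm X \<le> 1" and "n \<le> k"
  shows "norm (sqrt_iter X k - sqrt_iter X n) \<le> sqrt_iter_bound k - sqrt_iter_bound n"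
  using \<open>n \<le> k\<close>
proof (induction k rule: dec_induct)
  case (step k)
  have "norm (sqrt_iter X (Suc k) - sqrt_iter X n)
      \<le> norm (sqrt_iter X (Suc k) - sqrt_iter X k) + norm (sqrt_iter X k - sqrt_iter X n)"
    using norm_triangle_ineq[of "sqrt_iter X (Suc k) - sqrt_iter X k" "sqrt_iter X k - sqrt_iter X n"]
    by (simp del: sqrt_iter.simps)
  then show ?case
    using norm_sqrt_iter_step_le[OF assms(1), of k] step.IH by linarith
qed simp

lemma convergent_sqrt_iter:
  fixes X :: "'a::banach \<Rightarrow>\<^sub>L 'a"
  assumes "norm X \<le> 1"
  shows "convergent (sqrt_iter X)"
proof -
  have "Cauchy (sqrt_iter X)"
  proof (rule metric_CauchyI)
    fix e :: real assume "0 < e"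
    then obtain M where M: "\<And>k n. M \<le> k \<Longrightarrow> M \<le> n \<Longrightarrow> dist (sqrt_iter_bound k) (sqrt_iter_bound n) < e"
      using metric_CauchyD[OF convergent_Cauchy[OF convergent_sqrt_iter_bound]] by metis
    have "dist (sqrt_iter X k) (sqrt_iter X n) < e" if "M \<le> k" "M \<le> n" for k n
    proof -
      have "dist (sqrt_iter X k) (sqrt_iter X n) \<le> dist (sqrt_iter_bound k) (sqrt_iter_bound n)"
        using norm_sqrt_iter_diff_le[OF assms, of n k] norm_sqrt_iter_diff_le[OF assms, of k n]
        by (cases "n \<le> k") (auto simp: dist_norm norm_minus_commute)
      then show ?thesis
        using M[OF that] by linarith
    qed
    then show "\<exists>M. \<forall>k\<ge>M. \<forall>n\<ge>M. dist (sqrt_iter X k) (sqrt_iter X n) < e"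
      by blast
  qed
  then show ?thesis
    by (simp add: Cauchy_convergent_iff)
qed

lemma selfadjoint_op_sqrt_iter: "selfadjoint_op X \<Longrightarrow> selfadjoint_op (sqrt_iter X n)"
  by (induction n)
    (simp_all add: selfadjoint_op_zero selfadjoint_op_add selfadjoint_op_scaleR selfadjoint_op_square)

lemma sqrt_iter_commute:
  fixes C X :: "'a::real_normed_vector \<Rightarrow>\<^sub>L 'a"
  assumes "\<And>x. C (X x) = X (C x)"
  shows "C (sqrt_iter X n x) = sqrt_iter X n (C x)"
  by (induction n arbitrary: x) (simp_all add: blinfun.bilinear_simps assms)

text \<open>
  The statement records that the square root commutes with every operator \<open>C\<close> that commutes with
  \<open>A\<close>, because the uniqueness argument compares it with another square root of \<open>A\<close> and needs the
  two to commute. The property holds for each iterate, which is a polynomial in \<open>A\<close>, and passes to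
  the limit. The limit \<open>Y\<close> has norm at most \<open>1\<close>, which makes \<open>1 - Y\<close> positive.
\<close>

lemma positive_sqrt_exists_contraction:
  fixes A :: "'a::chilbert_space \<Rightarrow>\<^sub>L 'a"
  assumes A: "positive_op A" and "norm A \<le> 1"
  shows "\<exists>B. positive_op B \<and> B o\<^sub>L B = A \<and>
    (\<forall>C :: 'a \<Rightarrow>\<^sub>L 'a. (\<forall>x. C (A x) = A (C x)) \<longrightarrow> (\<forall>x. C (B x) = B (C x)))"
proof -
  define X where "X = id_blinfun - A"
  have X: "norm X \<le> 1"
    unfolding X_def using assms by (rule norm_id_minus_positive_op_le)
  have saX: "selfadjoint_op X"
    unfolding X_def
    by (intro selfadjoint_op_diff selfadjoint_op_id positive_op_imp_selfadjoint_op A)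
  obtain Y where Y: "sqrt_iter X \<longlonglongrightarrow> Y"
    using convergent_sqrt_iter[OF X] convergent_def by blast
  have "(\<lambda>n. sqrt_iter X (Suc n)) \<longlonglongrightarrow> (1/2) *\<^sub>R (X + (Y o\<^sub>L Y))"
    unfolding sqrt_iter.simps
    by (intro tendsto_intros bounded_bilinear.tendsto[OF bounded_bilinear_blinfun_compose] Y)
  then have fixpoint: "Y = (1/2) *\<^sub>R (X + (Y o\<^sub>L Y))"
    using LIMSEQ_Suc[OF Y] LIMSEQ_unique by blast
  define B where "B = id_blinfun - Y"
  have "norm Y \<le> 1"
  proof (rule LIMSEQ_le_const2[OF tendsto_norm[OF Y]])
    show "\<exists>N. \<forall>n\<ge>N. norm (sqrt_iter X n) \<le> 1"
      using norm_sqrt_iter_le[OF X] sqrt_iter_bound_in_unit_interval order_trans by blast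
  qed
  have "positive_op B"
  proof (rule selfadjoint_op_imp_positive_op)
    show "selfadjoint_op B"
      unfolding B_def
      by (intro selfadjoint_op_diff selfadjoint_op_id selfadjoint_op_limit[OF _ Y]
          selfadjoint_op_sqrt_iter saX)
    show "0 \<le> Re (cinner (B x) x)" for x
    proof -
      have "Re (cinner (Y x) x) \<le> norm Y * (norm x)\<^sup>2"
        by (rule Re_cinner_image_le)
      also have "\<dots> \<le> 1 * (norm x)\<^sup>2"
        by (intro mult_right_mono \<open>norm Y \<le> 1\<close>) simp
      finally show ?thesis
        by (simp add: B_def blinfun.diff_left cinner.diff_left Re_cinner_self)
    qed
  qed
  moreover have "B o\<^sub>L B = A"
  proof (rule blinfun_eqI)
    fix x
    have "Y x = (1/2) *\<^sub>R (x - A x + Y (Y x))"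
      using arg_cong[OF fixpoint, of "\<lambda>Z. blinfun_apply Z x"]
      by (simp add: X_def blinfun.bilinear_simps)
    from arg_cong[OF this, of "scaleR 2"] have "2 *\<^sub>R Y x = x - A x + Y (Y x)"
      by (simp only: scaleR_scaleR) simp
    then show "(B o\<^sub>L B) x = A x"
      by (simp add: B_def blinfun.bilinear_simps scaleR_2 algebra_simps)
  qed
  moreover have "C (B x) = B (C x)" if "\<forall>x. C (A x) = A (C x)" for C :: "'a \<Rightarrow>\<^sub>L 'a" and x
  proof -
    have "C (sqrt_iter X n x) = sqrt_iter X n (C x)" for n
      using that by (intro sqrt_iter_commute) (simp add: X_def blinfun.bilinear_simps)
    moreover have "(\<lambda>n. C (sqrt_iter X n x)) \<longlonglongrightarrow> C (Y x)"
      by (intro blinfun.tendsto tendsto_const Y)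
    moreover have "(\<lambda>n. sqrt_iter X n (C x)) \<longlonglongrightarrow> Y (C x)"
      by (intro blinfun.tendsto tendsto_const Y)
    ultimately have "C (Y x) = Y (C x)"
      by (simp add: LIMSEQ_unique)
    then show ?thesis
      by (simp add: B_def blinfun.bilinear_simps)
  qed
  ultimately show ?thesis
    by blast
qed

lemma positive_op_scaleR:
  assumes "positive_op A" and "0 \<le> r"
  shows "positive_op (r *\<^sub>R A)"
proof (rule selfadjoint_op_imp_positive_op)
  show "selfadjoint_op (r *\<^sub>R A)"
    by (rule selfadjoint_op_scaleR[OF positive_op_imp_selfadjoint_op[OF assms(1)]])
  show "0 \<le> Re (cinner ((r *\<^sub>R A) x) x)" for x
    using assms(2) positive_op_Re_nonneg[OF assms(1), of x]
    by (simp add: blinfun.scaleR_left cinner.scaleR_left)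
qed

lemma positive_sqrt_exists:
  fixes A :: "'a::chilbert_space \<Rightarrow>\<^sub>L 'a"
  assumes A: "positive_op A"
  shows "\<exists>B. positive_op B \<and> B o\<^sub>L B = A \<and>
    (\<forall>C :: 'a \<Rightarrow>\<^sub>L 'a. (\<forall>x. C (A x) = A (C x)) \<longrightarrow> (\<forall>x. C (B x) = B (C x)))"
proof (cases "A = 0")
  case True
  then show ?thesis
    using positive_sqrt_exists_contraction[OF A] by simp
next
  case False
  define r where "r = sqrt (norm A)"
  have r: "0 < r" "r * r = norm A"
    using False by (simp_all add: r_def)
  define A' where "A' = (1 / norm A) *\<^sub>R A"
  have "positive_op A'" "norm A' \<le> 1"
    using False by (auto simp: A'_def intro: positive_op_scaleR[OF A])
  then obtain B where B: "positive_op B" "B o\<^sub>L B = A'"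
    "\<And>C :: 'a \<Rightarrow>\<^sub>L 'a. \<forall>x. C (A' x) = A' (C x) \<Longrightarrow> \<forall>x. C (B x) = B (C x)"
    using positive_sqrt_exists_contraction[of A'] by blast
  have "positive_op (r *\<^sub>R B)"
    using r by (intro positive_op_scaleR B) simp
  moreover have "(r *\<^sub>R B) o\<^sub>L (r *\<^sub>R B) = A"
  proof (rule blinfun_eqI)
    fix x
    have "B (B x) = A' x"
      using B(2) by (metis blinfun_compose.rep_eq comp_apply)
    then show "((r *\<^sub>R B) o\<^sub>L (r *\<^sub>R B)) x = A x"
      using r False by (simp add: A'_def blinfun.bilinear_simps)
  qed
  moreover have "C ((r *\<^sub>R B) x) = (r *\<^sub>R B) (C x)" if "\<forall>x. C (A x) = A (C x)"
    for C :: "'a \<Rightarrow>\<^sub>L 'a" and x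
    using B(3)[of C] that by (simp add: A'_def blinfun.bilinear_simps)
  ultimately show ?thesis
    by blast
qed

text \<open>
  For \<open>y = (B - C) x\<close> the commutation gives \<open>(B + C) y = (B\<^sup>2 - C\<^sup>2) x = 0\<close>, so the nonnegative numbers
  \<open>\<langle>By, y\<rangle>\<close> and \<open>\<langle>Cy, y\<rangle>\<close> add up to zero. Hence \<open>By = Cy = 0\<close>, and \<open>\<parallel>y\<parallel>\<^sup>2 = \<langle>x, (B - C) y\<rangle> = 0\<close>.
\<close>

lemma commuting_positive_sqrt_unique:
  assumes B: "positive_op B" and C: "positive_op C" and eq: "B o\<^sub>L B = C o\<^sub>L C"
    and comm: "\<And>x. B (C x) = C (B x)"
  shows "B = C"
proof (rule blinfun_eqI)
  fix x
  define y where "y = B x - C x"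
  have "B (B x) = C (C x)"
    using eq by (metis blinfun_compose.rep_eq comp_apply)
  then have "B y + C y = 0"
    by (simp add: y_def blinfun.diff_right comm)
  then have "Re (cinner (B y) y) + Re (cinner (C y) y) = 0"
    by (metis cinner.zero_left cinner_add_left plus_complex.sel(1) zero_complex.sel(1))
  then have "Re (cinner (B y) y) = 0" "Re (cinner (C y) y) = 0"
    using positive_op_Re_nonneg[OF B, of y] positive_op_Re_nonneg[OF C, of y] by linarith+
  then have "B y = 0" "C y = 0"
    using B C positive_op_eq_zero by blast+
  moreover have "cinner y y = cinner x (B y) - cinner x (C y)"
    using selfadjoint_opD[OF positive_op_imp_selfadjoint_op[OF B], of x y]
      selfadjoint_opD[OF positive_op_imp_selfadjoint_op[OF C], of x y]
    by (simp add: y_def cinner.diff_left)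
  ultimately have "cinner y y = 0"
    by (simp add: cinner.zero_right)
  then show "B x = C x"
    by (simp add: cinner_self y_def)
qed

theorem positive_sqrt_ex1:
  fixes A :: "'a::chilbert_space \<Rightarrow>\<^sub>L 'a"
  assumes "positive_op A"
  shows "\<exists>!B. positive_op B \<and> B o\<^sub>L B = A"
proof -
  obtain B where B: "positive_op B" "B o\<^sub>L B = A"
    and comm: "\<And>C :: 'a \<Rightarrow>\<^sub>L 'a. \<forall>x. C (A x) = A (C x) \<Longrightarrow> \<forall>x. C (B x) = B (C x)"
    using positive_sqrt_exists[OF assms] by blast
  have "C = B" if C: "positive_op C" "C o\<^sub>L C = A" for C
  proof (rule commuting_positive_sqrt_unique)
    have "\<forall>x. C (A x) = A (C x)"
      by (simp flip: C(2))
    then show "C (B x) = B (C x)" for x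
      using comm by blast
  qed (use B C in auto)
  with B show ?thesis by blast
qed

section \<open>The absolute value of an operator\<close>

lemma cinner_adjoint_op_self:
  assumes "clinear_op T"
  shows "cinner (adjoint_op T (T x)) x = complex_of_real ((norm (T x))\<^sup>2)"
proof -
  have "cinner (adjoint_op T (T x)) x = cnj (cinner (T x) (T x))"
    using cinner_adjoint_op[OF assms] cinner_commute by metis
  then show ?thesis
    by (simp add: cinner_self)
qed

lemma positive_op_adjoint_op_compose:
  assumes "clinear_op T"
  shows "positive_op (adjoint_op T o\<^sub>L T)"
  unfolding positive_op_def
proof (intro conjI allI)
  show "clinear_op (adjoint_op T o\<^sub>L T)"
    using assms clinear_op_adjoint_op[OF assms] by (simp add: clinear_op_def)
  show "cinner ((adjoint_op T o\<^sub>L T) x) x \<in> \<real>\<^sub>\<ge>\<^sub>0" for x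
    by (simp add: cinner_adjoint_op_self[OF assms] del: of_real_power)
qed

lemma abs_op_squared:
  assumes "clinear_op T"
  shows "abs_op T o\<^sub>L abs_op T = adjoint_op T o\<^sub>L T"
  using theI'[OF positive_sqrt_ex1[OF positive_op_adjoint_op_compose[OF assms]]]
  unfolding abs_op_def sqrt_op_def by blast

lemma Re_cinner_abs_op_squared:
  assumes "clinear_op T"
  shows "Re (cinner ((abs_op T o\<^sub>L abs_op T) x) x) = (norm (T x))\<^sup>2"
  by (simp add: abs_op_squared[OF assms] cinner_adjoint_op_self[OF assms] del: of_real_power)

section \<open>The numerical radius\<close>

lemma numerical_radius_squared_le:
  fixes T :: "'a::chilbert_space \<Rightarrow>\<^sub>L 'a"
  assumes "0 \<le> b" and "\<And>x. norm x = 1 \<Longrightarrow> (cmod (cinner (T x) x))\<^sup>2 \<le> b"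
  shows "(numerical_radius T)\<^sup>2 \<le> b"
proof -
  let ?S = "insert 0 {cmod (cinner (T x) x) |x. norm x = 1}"
  have bound: "s \<le> sqrt b" if "s \<in> ?S" for s
    using that assms by (auto intro: real_le_rsqrt)
  have "numerical_radius T \<le> sqrt b"
    unfolding numerical_radius_def using bound by (intro cSup_least) auto
  moreover have "0 \<le> numerical_radius T"
    unfolding numerical_radius_def using bound by (intro cSup_upper bdd_aboveI[of _ "sqrt b"]) auto
  ultimately have "(numerical_radius T)\<^sup>2 \<le> (sqrt b)\<^sup>2"
    by (intro power_mono)
  then show ?thesis
    using assms(1) by simp
qed

lemma numerical_radius_squared_le_convex_combination:
  fixes T :: "'a::chilbert_space \<Rightarrow>\<^sub>L 'a"
  assumes T: "clinear_op T" and "0 \<le> \<alpha>" "\<alpha> \<le> 1"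
  shows "(numerical_radius T)\<^sup>2 \<le> norm (\<alpha> *\<^sub>R (abs_op T o\<^sub>L abs_op T)
    + (1 - \<alpha>) *\<^sub>R (abs_op (adjoint_op T) o\<^sub>L abs_op (adjoint_op T)))"
    (is "_ \<le> norm ?M")
proof (rule numerical_radius_squared_le)
  fix x :: 'a assume x: "norm x = 1"
  let ?c = "(cmod (cinner (T x) x))\<^sup>2"
  have "?c \<le> (norm (T x))\<^sup>2"
    using cmod_cinner_le[of "T x" x] x by (intro power_mono) auto
  moreover have "?c \<le> (norm (adjoint_op T x))\<^sup>2"
    using cmod_cinner_le[of x "adjoint_op T x"] x
    by (intro power_mono) (auto simp: cinner_adjoint_op[OF T])
  ultimately have "\<alpha> * ?c + (1 - \<alpha>) * ?c \<le> \<alpha> * (norm (T x))\<^sup>2 + (1 - \<alpha>) * (norm (adjoint_op T x))\<^sup>2"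
    using assms by (intro add_mono mult_left_mono) auto
  also have "\<dots> = Re (cinner (?M x) x)"
    using Re_cinner_abs_op_squared[OF T, of x]
      Re_cinner_abs_op_squared[OF clinear_op_adjoint_op[OF T], of x]
    by (simp add: blinfun.add_left blinfun.scaleR_left cinner.add_left cinner.scaleR_left)
  also have "\<dots> \<le> norm ?M"
    using Re_cinner_image_le[of ?M x] x by simp
  finally show "?c \<le> norm ?M"
    by (simp add: algebra_simps)
qed simp

theorem corollary2p5:
  fixes T :: "'a::chilbert_space \<Rightarrow>\<^sub>L 'a"
  assumes "clinear_op T"
  shows "let N = (\<lambda>\<alpha>::real. norm (\<alpha> *\<^sub>R (abs_op T o\<^sub>L abs_op T)
                 + (1 - \<alpha>) *\<^sub>R (abs_op (adjoint_op T) o\<^sub>L abs_op (adjoint_op T))))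
         in \<exists>\<alpha>\<^sub>0\<in>{0..1}. (\<forall>\<alpha>\<in>{0..1}. N \<alpha>\<^sub>0 \<le> N \<alpha>) \<and> (numerical_radius T)\<^sup>2 \<le> N \<alpha>\<^sub>0"
proof -
  define N where "N \<alpha> = norm (\<alpha> *\<^sub>R (abs_op T o\<^sub>L abs_op T)
    + (1 - \<alpha>) *\<^sub>R (abs_op (adjoint_op T) o\<^sub>L abs_op (adjoint_op T)))" for \<alpha> :: real
  have "continuous_on {0..1} N"
    unfolding N_def by (intro continuous_intros)
  then obtain \<alpha>\<^sub>0 where "\<alpha>\<^sub>0 \<in> {0..1}" "\<forall>\<alpha>\<in>{0..1}. N \<alpha>\<^sub>0 \<le> N \<alpha>"
    using continuous_attains_inf[of "{0..1::real}" N] by auto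
  moreover from this have "(numerical_radius T)\<^sup>2 \<le> N \<alpha>\<^sub>0"
    unfolding N_def
    by (intro numerical_radius_squared_le_convex_combination assms) auto
  ultimately show ?thesis
    unfolding Let_def N_def by blast
qed

end
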